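(* Let $f:\mathbb{R}^n\to\mathbb{R}$ be a convex function whose gradient is Lipschitz continuous with respect to $\|\cdot\|_2$ with constant $L_f>0$, and let $x_\star$ be a solution of $\min_{y\in\mathbb{R}^n}f(y)$. Consider the Catalyst algorithm defined in the context with $L_{k+1}\equiv L_f$ for all $k$, applied to $\min_{y\in\mathbb{R}^n}f(y)$, with a non-randomized inner method $\mathcal{M}$ that satisfies the convergence rate assumption (stated in the context) with constants $C_n$ and $L_f$. Let $R=\|y^0-x_\star\|_2$ and $\varepsilon>0$. Then the total complexity of the algorithm with inner method $\mathcal{M}$, i.e. the total number of oracle calls (iterations) of $\mathcal{M}$ required to find an $\varepsilon$-solution in terms of function value (a point $y^N$ with $f(y^N)-f(x_\star)\le\varepsilon$), is $$O\left(C_n\sqrt{\frac{L_fR^2}{\varepsilon}}\right).$$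
   Context: Notation. For $L>0$ and $x\in\mathbb{R}^n$ put $F_{L,x}(y)=f(y)+\frac{L}{2}\|y-x\|_2^2$. The function $F_{L,x}$ is $L$-strongly convex and its gradient is $(L+L_f)$-Lipschitz. Convergence rate assumption on the (non-randomized, non-accelerated) inner method $\mathcal{M}$. Applied to $\min_{y\in\mathbb{R}^n}F(y)$, where $F$ is $\mu_F$-strongly convex with smoothness constant $L_F$, with starting point $y^0$ and solution $y_\star$, and with $R_y=\|y^0-y_\star\|_2$, the point $y_t$ produced by $\mathcal{M}$ after $t$ iterations (oracle calls) satisfies $$F(y_t)-F(y_\star)=O\left(L_FR_y^2\right)\min\left\{\tfrac{C_n}{t},\exp\left(-\tfrac{\mu_Ft}{C_nL_F}\right)\right\}.$$ For the auxiliary functions $F=F_{L,x}$ one has $\mu_F=L$ and $L_F=L_f+L$. Algorithm (the Adaptive Catalyst algorithm in non-adaptive mode, where the regularization parameter is fixed to $L_{k+1}\equiv L_f$, so no search over $L_{k+1}$ is performed). Start from $x^0=y^0=z^0\in\mathbb{R}^n$, $A_0=0$. For $k=0,1,\dots,N-1$, with $L_{k+1}=L_f$: (a) compute $a_{k+1}=\frac{1/L_{k+1}+\sqrt{1/L_{k+1}^2+4A_k/L_{k+1}}}{2}$, $A_{k+1}=A_k+a_{k+1}$, $x^{k+1}=\frac{A_k}{A_{k+1}}y^k+\frac{a_{k+1}}{A_{k+1}}z^k$; (b) run $\mathcal{M}$ on $\min_yF_{L_{k+1},x^{k+1}}(y)$ from the starting point $x^{k+1}$ until its output point $y^{k+1}$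 satisfies $\|\nabla F_{L_{k+1},x^{k+1}}(y^{k+1})\|_2\le\frac{L_{k+1}}{2}\|y^{k+1}-x^{k+1}\|_2$; (c) set $z^{k+1}=z^k-a_{k+1}\nabla f(y^{k+1})$. Output: $y^N$. All iterations of $\mathcal{M}$ over all outer iterations are counted in the total complexity. *)

theory Defs
  imports "HOL-Analysis.Analysis"
begin

definition gradient :: "('a::real_inner \<Rightarrow> real) \<Rightarrow> 'a \<Rightarrow> 'a" where
  "gradient f x = (THE D. GDERIV f x :> D)"

definition smooth_function :: "real \<Rightarrow> ('a::real_inner \<Rightarrow> real) \<Rightarrow> bool" where
  "smooth_function L f \<longleftrightarrow>
     (\<forall>x. \<exists>D. GDERIV f x :> D) \<and> L-lipschitz_on UNIV (gradient f)"

definition strongly_convex :: "real \<Rightarrow> ('a::real_inner \<Rightarrow> real) \<Rightarrow> bool" where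
  "strongly_convex \<mu> f \<longleftrightarrow>
     (\<forall>x y t. 0 \<le> t \<and> t \<le> 1 \<longrightarrow>
        f ((1 - t) *\<^sub>R x + t *\<^sub>R y)
          \<le> (1 - t) * f x + t * f y - \<mu> / 2 * t * (1 - t) * (norm (x - y))\<^sup>2)"

definition aux_function :: "('a::real_inner \<Rightarrow> real) \<Rightarrow> real \<Rightarrow> 'a \<Rightarrow> 'a \<Rightarrow> real" where
  "aux_function f L x = (\<lambda>y. f y + L / 2 * (norm (y - x))\<^sup>2)"

text \<open>
  A deterministic method maps an objective \<open>F\<close>, a starting point and a number \<open>t \<ge> 1\<close> of
  iterations (oracle calls) to the point produced after \<open>t\<close> iterations.
\<close>

type_synonym 'a inner_method = "('a \<Rightarrow> real) \<Rightarrow> 'a \<Rightarrow> nat \<Rightarrow> 'a"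

text \<open>
  The parameter \<open>c\<close> is the absolute constant implied by the factor \<open>O(L\<^sub>F R\<^sub>y\<^sup>2)\<close>; it is the same
  for all objectives, starting points and iteration counts.
\<close>

definition convergence_rate :: "'a::real_inner inner_method \<Rightarrow> real \<Rightarrow> real \<Rightarrow> bool" where
  "convergence_rate M c C \<longleftrightarrow>
     (\<forall>F \<mu> L y0 ys. \<forall>t\<ge>1.
        0 < \<mu> \<longrightarrow> strongly_convex \<mu> F \<longrightarrow> smooth_function L F \<longrightarrow> (\<forall>y. F ys \<le> F y) \<longrightarrow>
        F (M F y0 t) - F ys
          \<le> c * (L * (norm (y0 - ys))\<^sup>2) * min (C / real t) (exp (- (\<mu> * real t) / (C * L))))"

definition stopping_test :: "('a::real_inner \<Rightarrow> real) \<Rightarrow> real \<Rightarrow> 'a \<Rightarrow> 'a \<Rightarrow> bool" where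
  "stopping_test f L x y \<longleftrightarrow>
     norm (gradient (aux_function f L x) y) \<le> L / 2 * norm (y - x)"

text \<open>
  The sequences form a trace of \<open>N\<close> outer iterations started in \<open>x0\<close>, with regularisation
  parameters \<open>L 1, \<dots>, L N\<close>. \<open>T (Suc k)\<close> is the number of iterations of \<open>M\<close> spent in outer
  iteration \<open>k\<close>: the test is evaluated after each of them and \<open>M\<close> is stopped the first time it
  holds. The entries up to index \<open>N\<close> are uniquely determined; a trace exists iff the inner loop
  terminates in each of the \<open>N\<close> outer iterations.
\<close>

definition catalyst_run ::
  "('a::real_inner \<Rightarrow> real) \<Rightarrow> 'a inner_method \<Rightarrow> (nat \<Rightarrow> real) \<Rightarrow> 'a \<Rightarrow> nat \<Rightarrow>
   (nat \<Rightarrow> 'a) \<Rightarrow> (nat \<Rightarrow> 'a) \<Rightarrow> (nat \<Rightarrow> 'a) \<Rightarrow> (nat \<Rightarrow> real) \<Rightarrow> (nat \<Rightarrow> real) \<Rightarrow> (nat \<Rightarrow> nat) \<Rightarrow> bool"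
where
  "catalyst_run f M L x0 N x y z A a T \<longleftrightarrow>
     x 0 = x0 \<and> y 0 = x0 \<and> z 0 = x0 \<and> A 0 = 0 \<and>
     (\<forall>k<N.
        a (Suc k) = (1 / L (Suc k) + sqrt (1 / (L (Suc k))\<^sup>2 + 4 * A k / L (Suc k))) / 2 \<and>
        A (Suc k) = A k + a (Suc k) \<and>
        x (Suc k) = (A k / A (Suc k)) *\<^sub>R y k + (a (Suc k) / A (Suc k)) *\<^sub>R z k \<and>
        (let m = M (aux_function f (L (Suc k)) (x (Suc k))) (x (Suc k));
             stop = stopping_test f (L (Suc k)) (x (Suc k))
         in 1 \<le> T (Suc k) \<and> stop (m (T (Suc k))) \<and>
            (\<forall>t. 1 \<le> t \<and> t < T (Suc k) \<longrightarrow> \<not> stop (m t)) \<and>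
            y (Suc k) = m (T (Suc k))) \<and>
        z (Suc k) = z k - a (Suc k) *\<^sub>R gradient f (y (Suc k)))"

text \<open>
  The constant implied by the \<open>O\<close> of the complexity bound, for methods with rate constants
  \<open>c\<close> and \<open>C\<^sub>n \<ge> C0\<close>. It is written out, and not existentially quantified in the theorem,
  because the dimension is a type parameter there: an existential constant could depend on the
  dimension, whereas this one visibly depends on \<open>c\<close> and \<open>C0\<close> only. The number 1000 is not
  meant to be sharp. Some lower bound \<open>C0\<close> is needed (\<open>C0 = 1\<close> in the usual case): each outer
  iteration costs at least one call, while a method returning exact minimisers satisfies the
  rate assumption for every \<open>C\<^sub>n > 0\<close>.
\<close>

definition complexity_constant :: "real \<Rightarrow> real \<Rightarrow> real" where
  "complexity_constant c C0 = 1000 * (c + 1 / C0)"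

end

theory Submission
  imports Defs
begin

text \<open>
  With \<open>L = L\<^sub>f\<close> every auxiliary problem has condition number 2, so already the \<open>C\<^sub>n / t\<close> branch
  of the rate makes the relative stopping test succeed after at most \<open>72 c C\<^sub>n + 1\<close> calls.
  The test is the inexactness criterion of Monteiro and Svaiter, under which
  \<open>A\<^sub>k (f y\<^sub>k - f x\<^sub>\<star>) + \<parallel>z\<^sub>k - x\<^sub>\<star>\<parallel>\<^sup>2 / 2\<close> does not increase; since \<open>A\<^sub>k \<ge> k\<^sup>2 / (4 L)\<close>, about
  \<open>\<surd>(2 L R\<^sup>2 / \<epsilon>)\<close> outer iterations suffice. If the starting point is not already an
  \<open>\<epsilon>\<close>-solution, then \<open>\<epsilon> < L R\<^sup>2 / 2\<close>, which absorbs the rounding of that number.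
\<close>

section \<open>Calculus of gradients for smooth and convex functions\<close>

lemma gradient_eq:
  assumes "GDERIV f x :> D"
  shows "gradient f x = D"
  unfolding gradient_def
proof (rule the_equality)
  fix E assume "GDERIV f x :> E"
  then have "(\<lambda>h. inner h E) = (\<lambda>h. inner h D)"
    using assms unfolding gderiv_def by (rule has_derivative_unique)
  then have "inner (E - D) E = inner (E - D) D" by metis
  then have "inner (E - D) (E - D) = 0" by (simp add: inner_diff_right)
  then show "E = D" by simp
qed (fact assms)

lemma smooth_function_GDERIV:
  assumes "smooth_function L f"
  shows "GDERIV f x :> gradient f x"
proof -
  obtain D where "GDERIV f x :> D"
    using assms unfolding smooth_function_def by blast
  then show ?thesis by (simp only: gradient_eq)
qed

text \<open>Restriction to a line reduces both the tangent inequality and the descent lemma to one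
  real variable.\<close>

lemma GDERIV_along_line:
  assumes "\<And>x. GDERIV f x :> g x"
  shows "((\<lambda>t. f (x + t *\<^sub>R d)) has_real_derivative inner d (g (x + t *\<^sub>R d))) (at t within S)"
proof -
  have "((\<lambda>t. x + t *\<^sub>R d) has_derivative (\<lambda>h. h *\<^sub>R d)) (at t within S)"
    by (auto intro!: derivative_eq_intros)
  moreover have "(f has_derivative (\<lambda>h. inner h (g (x + t *\<^sub>R d)))) (at (x + t *\<^sub>R d))"
    using assms unfolding gderiv_def by blast
  ultimately have "((\<lambda>t. f (x + t *\<^sub>R d)) has_derivative
      (\<lambda>h. inner (h *\<^sub>R d) (g (x + t *\<^sub>R d)))) (at t within S)"
    by (rule has_derivative_compose)
  then show ?thesis
    by (simp add: has_field_derivative_def mult_commute_abs)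
qed

lemma convex_gradient_inequality:
  assumes "convex_on UNIV f" "smooth_function L f"
  shows "f y \<ge> f x + inner (gradient f x) (y - x)"
proof -
  define d where "d = y - x"
  have "convex_on UNIV (\<lambda>t. f (x + t *\<^sub>R d))"
  proof (rule convex_onI)
    fix t u v :: real assume t: "0 < t" "t < 1"
    have "x + ((1 - t) *\<^sub>R u + t *\<^sub>R v) *\<^sub>R d = (1 - t) *\<^sub>R (x + u *\<^sub>R d) + t *\<^sub>R (x + v *\<^sub>R d)"
      by (simp add: algebra_simps)
    then show "f (x + ((1 - t) *\<^sub>R u + t *\<^sub>R v) *\<^sub>R d)
        \<le> (1 - t) * f (x + u *\<^sub>R d) + t * f (x + v *\<^sub>R d)"
      using convex_onD[OF assms(1), of t "x + u *\<^sub>R d" "x + v *\<^sub>R d"] t by simp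
  qed simp
  \<comment> \<open>The tangent of the restriction at parameter 0 is evaluated at parameter
    1.\<close>
  from convex_on_imp_above_tangent[OF this _ _ _
      GDERIV_along_line[OF smooth_function_GDERIV[OF assms(2)]], of 0 1]
  show ?thesis by (simp add: d_def inner_commute)
qed

lemma descent_lemma:
  assumes "smooth_function L f"
  shows "f y \<le> f x + inner (gradient f x) (y - x) + L / 2 * (norm (y - x))\<^sup>2"
proof -
  define d where "d = y - x"
  define g where "g = gradient f"
  \<comment> \<open>Up to the constant \<open>f x\<close>, this is the restriction of
    \<open>f\<close> minus its quadratic upper bound. Its derivative is nonpositive for nonnegative
    \<open>t\<close> by Cauchy-Schwarz and the Lipschitz bound, so comparing the values at 1 and 0
    replaces an integral.\<close>
  define \<phi> where "\<phi> = (\<lambda>t. f (x + t *\<^sub>R d) - t * inner d (g x) - L / 2 * t\<^sup>2 * (norm d)\<^sup>2)"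
  have deriv: "(\<phi> has_real_derivative inner d (g (x + t *\<^sub>R d)) - inner d (g x) - L * t * (norm d)\<^sup>2) (at t)"
    for t
    unfolding \<phi>_def g_def
    by (auto intro!: derivative_eq_intros GDERIV_along_line smooth_function_GDERIV[OF assms])
  have nonpos: "inner d (g (x + t *\<^sub>R d)) - inner d (g x) - L * t * (norm d)\<^sup>2 \<le> 0" if "0 \<le> t" for t
  proof -
    have "inner d (g (x + t *\<^sub>R d)) - inner d (g x) = inner d (g (x + t *\<^sub>R d) - g x)"
      by (simp add: inner_diff_right)
    also have "\<dots> \<le> norm d * norm (g (x + t *\<^sub>R d) - g x)"
      by (rule norm_cauchy_schwarz)
    also have "\<dots> \<le> norm d * (L * norm (t *\<^sub>R d))"
      using assms lipschitz_onD[of L UNIV g "x + t *\<^sub>R d" x]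
      by (intro mult_left_mono) (auto simp: smooth_function_def g_def dist_norm)
    finally show ?thesis using that by (simp add: power2_eq_square algebra_simps)
  qed
  have "\<phi> 1 \<le> \<phi> 0"
  proof (rule DERIV_nonpos_imp_nonincreasing[where f = \<phi>])
    show "\<exists>D. (\<phi> has_real_derivative D) (at t) \<and> D \<le> 0" if "0 \<le> t" for t
      using deriv[of t] nonpos[OF that] by blast
  qed simp
  then show ?thesis by (simp add: \<phi>_def d_def g_def inner_commute)
qed

text \<open>A gradient step of size \<open>1 / L\<close> lowers \<open>f\<close> by at least the
  squared gradient norm over \<open>2 * L\<close>, and it cannot go below the minimum.\<close>

lemma gradient_norm_le_gap:
  assumes "smooth_function L f" "0 < L" "\<And>y. f ys \<le> f y"
  shows "(norm (gradient f x))\<^sup>2 \<le> 2 * L * (f x - f ys)"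
proof -
  define g where "g = gradient f x"
  have "f ys \<le> f (x - (1 / L) *\<^sub>R g)" by (rule assms)
  also have "\<dots> \<le> f x - 1 / (2 * L) * (norm g)\<^sup>2"
    using descent_lemma[OF assms(1), of "x - (1 / L) *\<^sub>R g" x] assms(2)
    by (simp add: g_def flip: power2_norm_eq_inner) (simp add: power2_eq_square field_simps)
  finally show ?thesis using assms(2) by (simp add: g_def field_simps)
qed

text \<open>Strong convexity is used only at the midpoint of \<open>ys\<close> and \<open>y\<close>.
  This needs no derivative and gives the factor 4 instead of the sharp 2.\<close>

lemma strongly_convex_dist_le_gap:
  assumes "strongly_convex \<mu> F" "\<And>y. F ys \<le> F y"
  shows "\<mu> * (norm (y - ys))\<^sup>2 \<le> 4 * (F y - F ys)"
proof -
  have "F ((1 - 1/2) *\<^sub>R ys + (1/2) *\<^sub>R y)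
      \<le> (1 - 1/2) * F ys + 1/2 * F y - \<mu> / 2 * (1/2) * (1 - 1/2) * (norm (ys - y))\<^sup>2"
    by (rule assms(1)[unfolded strongly_convex_def, rule_format]) simp
  with assms(2)[of "(1 - 1/2) *\<^sub>R ys + (1/2) *\<^sub>R y"] show ?thesis
    by (simp add: norm_minus_commute)
qed

section \<open>Auxiliary functions: strong convexity, smoothness, existence of a minimiser\<close>

lemma strongly_convex_aux_function:
  assumes "convex_on UNIV f"
  shows "strongly_convex L (aux_function f L x)"
  unfolding strongly_convex_def
proof (intro allI impI, elim conjE)
  fix u v :: 'a and t :: real assume t: "0 \<le> t" "t \<le> 1"
  \<comment> \<open>For the squared norm the strong convexity inequality is an identity, so adding
    the plain convexity of \<open>f\<close> yields the modulus \<open>L\<close>.\<close>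
  have "(norm ((1 - t) *\<^sub>R u + t *\<^sub>R v - x))\<^sup>2
      = (1 - t) * (norm (u - x))\<^sup>2 + t * (norm (v - x))\<^sup>2 - t * (1 - t) * (norm (u - v))\<^sup>2"
    unfolding power2_norm_eq_inner by (simp add: algebra_simps inner_commute)
  then have "L / 2 * (norm ((1 - t) *\<^sub>R u + t *\<^sub>R v - x))\<^sup>2 = (1 - t) * (L / 2 * (norm (u - x))\<^sup>2)
      + t * (L / 2 * (norm (v - x))\<^sup>2) - L / 2 * t * (1 - t) * (norm (u - v))\<^sup>2"
    by (simp only:) (simp add: field_simps)
  moreover have "f ((1 - t) *\<^sub>R u + t *\<^sub>R v) \<le> (1 - t) * f u + t * f v"
    using convex_onD[OF assms] t by blast
  ultimately show "aux_function f L x ((1 - t) *\<^sub>R u + t *\<^sub>R v)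
      \<le> (1 - t) * aux_function f L x u + t * aux_function f L x v
        - L / 2 * t * (1 - t) * (norm (u - v))\<^sup>2"
    unfolding aux_function_def by (simp only: distrib_left)
qed

lemma GDERIV_aux_function:
  assumes "GDERIV f y :> D"
  shows "GDERIV (aux_function f L x) y :> D + L *\<^sub>R (y - x)"
proof -
  have "((\<lambda>y. inner (y - x) (y - x)) has_derivative (\<lambda>h. inner (y - x) h + inner h (y - x))) (at y)"
    by (rule has_derivative_eq_rhs, rule has_derivative_inner) (auto intro!: derivative_eq_intros)
  from has_derivative_add[OF assms[unfolded gderiv_def] has_derivative_mult_right[OF this, of "L / 2"]]
  show ?thesis
    unfolding gderiv_def aux_function_def power2_norm_eq_inner
    by (rule has_derivative_eq_rhs) (simp add: fun_eq_iff inner_add_right inner_commute)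
qed

lemma gradient_aux_function:
  assumes "smooth_function K f"
  shows "gradient (aux_function f L x) y = gradient f y + L *\<^sub>R (y - x)"
  by (rule gradient_eq[OF GDERIV_aux_function[OF smooth_function_GDERIV[OF assms]]])

lemma smooth_aux_function:
  assumes "smooth_function K f" "0 \<le> L"
  shows "smooth_function (K + L) (aux_function f L x)"
proof -
  have "L-lipschitz_on UNIV (\<lambda>y. L *\<^sub>R (y - x))"
    using assms(2) by (intro lipschitz_onI) (auto simp: dist_norm simp flip: scaleR_diff_right)
  then have "(K + L)-lipschitz_on UNIV (\<lambda>y. gradient f y + L *\<^sub>R (y - x))"
    using assms(1) by (intro lipschitz_on_add) (auto simp: smooth_function_def)
  moreover have "gradient (aux_function f L x) = (\<lambda>y. gradient f y + L *\<^sub>R (y - x))"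
    using gradient_aux_function[OF assms(1)] by blast
  ultimately have "(K + L)-lipschitz_on UNIV (gradient (aux_function f L x))"
    by (simp only:)
  then show ?thesis
    using GDERIV_aux_function[OF smooth_function_GDERIV[OF assms(1)]]
    unfolding smooth_function_def by blast
qed

text \<open>The rate assumption compares with a minimiser of the objective, so one has to be
  exhibited. As \<open>f\<close> is bounded below, the quadratic term dominates outside a ball, and
  the ball is compact.\<close>

lemma aux_function_attains_min:
  fixes f :: "'a::euclidean_space \<Rightarrow> real"
  assumes "smooth_function K f" "0 < L" "\<And>y. m \<le> f y"
  obtains ys where "\<And>y. aux_function f L x ys \<le> aux_function f L x y"
proof -
  let ?F = "aux_function f L x"
  \<comment> \<open>Chosen so that outside the ball the auxiliary function is at least
    \<open>m + L / 2 * r^2 = f x\<close>, its value at the centre.\<close>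
  define r where "r = sqrt (2 * (f x - m) / L)"
  have r: "0 \<le> r" "L / 2 * r\<^sup>2 = f x - m"
    using assms(2) assms(3)[of x] by (auto simp: r_def)
  have "continuous_on UNIV ?F"
    using GDERIV_aux_function[OF smooth_function_GDERIV[OF assms(1)]]
    unfolding gderiv_def by (blast intro: has_derivative_continuous continuous_at_imp_continuous_on)
  then have "continuous_on (cball x r) ?F"
    using continuous_on_subset by blast
  with r(1) obtain ys where ys: "ys \<in> cball x r" "\<forall>y\<in>cball x r. ?F ys \<le> ?F y"
    using continuous_attains_inf[of "cball x r" ?F] by auto
  have "?F ys \<le> ?F y" for y
  proof (cases "y \<in> cball x r")
    case False
    then have "r\<^sup>2 \<le> (norm (y - x))\<^sup>2"
      using r(1) by (intro power_mono) (auto simp: dist_norm norm_minus_commute)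
    then have "L / 2 * r\<^sup>2 \<le> L / 2 * (norm (y - x))\<^sup>2"
      using assms(2) by (intro mult_left_mono) auto
    then have "?F x \<le> ?F y"
      using r(2) assms(3)[of y] by (simp add: aux_function_def)
    moreover have "?F ys \<le> ?F x" using ys(2) r(1) by simp
    ultimately show ?thesis by linarith
  qed (use ys in blast)
  then show ?thesis using that by blast
qed

section \<open>Cost of the inner loop\<close>

text \<open>Let \<open>r\<close> be the distance from \<open>x\<close> to the minimiser. The
  constant 72 makes the gap at most \<open>L * r^2 / 36\<close>, which bounds the gradient norm by
  \<open>L * r / 3\<close> and puts the output within \<open>r / 3\<close> of the minimiser. The
  output is then at least \<open>2 * r / 3\<close> away from \<open>x\<close>, and
  \<open>L / 2\<close> times that is again \<open>L * r / 3\<close>.\<close>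

lemma inner_stopping_test:
  fixes f :: "'a::euclidean_space \<Rightarrow> real"
  assumes "convex_on UNIV f" "0 < L" "smooth_function L f" "\<And>y. m \<le> f y"
    and "0 < c" "0 < C" "convergence_rate M c C"
    and t: "1 \<le> t" "72 * c * C \<le> real t"
  shows "stopping_test f L x (M (aux_function f L x) x t)"
proof -
  let ?F = "aux_function f L x"
  obtain ys where ys: "\<And>y. ?F ys \<le> ?F y"
    using aux_function_attains_min[OF assms(3,2,4)] by blast
  define y where "y = M ?F x t"
  define r where "r = norm (x - ys)"
  have sm: "smooth_function (2 * L) ?F"
    using smooth_aux_function[OF assms(3), of L x] assms(2) by simp
  have sc: "strongly_convex L ?F"
    by (rule strongly_convex_aux_function[OF assms(1)])
  have "?F y - ?F ys \<le> c * (2 * L * r\<^sup>2) * min (C / real t) (exp (- (L * real t) / (C * (2 * L))))"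
    using assms(7) sm sc ys t(1) assms(2) unfolding convergence_rate_def y_def r_def by blast
  also have "\<dots> \<le> c * (2 * L * r\<^sup>2) * (C / real t)"
    using assms(2,5) by (intro mult_left_mono) auto
  also have "\<dots> = 2 * L * r\<^sup>2 * (c * C / real t)" by simp
  also have "\<dots> \<le> 2 * L * r\<^sup>2 * (1 / 72)"
    using assms(2) t by (intro mult_left_mono) (auto simp: field_simps)
  finally have gap: "?F y - ?F ys \<le> L * r\<^sup>2 / 36" by simp
  have "(norm (gradient ?F y))\<^sup>2 \<le> 2 * (2 * L) * (?F y - ?F ys)"
    using gradient_norm_le_gap[OF sm _ ys] assms(2) by simp
  also have "\<dots> \<le> 2 * (2 * L) * (L * r\<^sup>2 / 36)"
    using gap assms(2) by (intro mult_left_mono) auto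
  also have "\<dots> = (L * r / 3)\<^sup>2" by (simp add: power2_eq_square)
  finally have grad: "norm (gradient ?F y) \<le> L * r / 3"
    by (rule power2_le_imp_le) (use assms(2) in \<open>simp add: r_def\<close>)
  have "L * (norm (y - ys))\<^sup>2 \<le> L * (r / 3)\<^sup>2"
    using strongly_convex_dist_le_gap[OF sc ys, of y] gap by (simp add: power_divide)
  then have "(norm (y - ys))\<^sup>2 \<le> (r / 3)\<^sup>2"
    using assms(2) by simp
  then have "norm (y - ys) \<le> r / 3"
    by (rule power2_le_imp_le) (simp add: r_def)
  moreover have "r \<le> norm (y - x) + norm (y - ys)"
    using dist_triangle[of x ys y] by (simp add: r_def dist_norm norm_minus_commute)
  ultimately have "2 * r / 3 \<le> norm (y - x)" by simp
  then have "L / 2 * (2 * r / 3) \<le> L / 2 * norm (y - x)"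
    using assms(2) by (intro mult_left_mono) auto
  with grad show ?thesis
    unfolding stopping_test_def y_def[symmetric] by simp
qed

text \<open>A run stops at the first success, hence the least \<open>t\<close> is taken; rounding up
  to an integer costs the additional 1.\<close>

lemma inner_loop_terminates:
  fixes f :: "'a::euclidean_space \<Rightarrow> real"
  assumes "convex_on UNIV f" "0 < L" "smooth_function L f" "\<And>y. m \<le> f y"
    and "0 < c" "0 < C" "convergence_rate M c C"
  obtains t where "1 \<le> t" "stopping_test f L x (M (aux_function f L x) x t)"
    "\<And>s. 1 \<le> s \<Longrightarrow> s < t \<Longrightarrow> \<not> stopping_test f L x (M (aux_function f L x) x s)"
    "real t \<le> 72 * c * C + 1"
proof -
  define P where "P = (\<lambda>t. 1 \<le> t \<and> stopping_test f L x (M (aux_function f L x) x t))"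
  define t0 where "t0 = nat \<lceil>72 * c * C\<rceil>"
  \<comment> \<open>Positivity makes the ceiling at least 1, the smallest iteration count that the
    rate covers.\<close>
  have pos: "0 < 72 * c * C" using assms(5,6) by simp
  then have t0: "1 \<le> t0" "72 * c * C \<le> real t0" "real t0 \<le> 72 * c * C + 1"
    unfolding t0_def by linarith+
  then have P: "P t0"
    using inner_stopping_test[OF assms] unfolding P_def by blast
  define t where "t = (LEAST t. P t)"
  have "P t" "\<And>s. s < t \<Longrightarrow> \<not> P s"
    unfolding t_def using LeastI[of P, OF P] not_less_Least by blast+
  moreover have "real t \<le> 72 * c * C + 1"
    using Least_le[of P, OF P] t0(3) unfolding t_def by linarith
  ultimately show ?thesis
    using that[of t] unfolding P_def by blast
qed

section \<open>Existence of runs\<close>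

text \<open>One infinite run serves every \<open>N\<close>, so the number of outer iterations can be
  chosen after the sequences are fixed.\<close>

lemma catalyst_run_exists:
  fixes f :: "'a::euclidean_space \<Rightarrow> real"
  assumes "convex_on UNIV f" "0 < L" "smooth_function L f" "\<And>y. m \<le> f y"
    and "0 < c" "0 < C" "convergence_rate M c C"
  obtains x y z A a T where "\<And>N. catalyst_run f M (\<lambda>_. L) x0 N x y z A a T"
    "\<And>k. 1 \<le> k \<Longrightarrow> real (T k) \<le> 72 * c * C + 1"
proof -
  \<comment> \<open>One outer iteration as a relation between successive states. It includes the
    bound on the calls, so that dependent choice delivers it together with the run.\<close>
  define Q where "Q = (\<lambda>(n::nat) (x :: 'a, y, z, A :: real, a :: real, T :: nat) (x', y', z', A', a', T').
     a' = (1 / L + sqrt (1 / L\<^sup>2 + 4 * A / L)) / 2 \<and> A' = A + a' \<and>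
     x' = (A / A') *\<^sub>R y + (a' / A') *\<^sub>R z \<and>
     1 \<le> T' \<and> stopping_test f L x' (M (aux_function f L x') x' T') \<and>
     (\<forall>s. 1 \<le> s \<and> s < T' \<longrightarrow> \<not> stopping_test f L x' (M (aux_function f L x') x' s)) \<and>
     y' = M (aux_function f L x') x' T' \<and> z' = z - a' *\<^sub>R gradient f y' \<and>
     real T' \<le> 72 * c * C + 1)"
  \<comment> \<open>Only the initial state is pinned; its entries for \<open>a\<close> and
    \<open>T\<close> are fillers, since iterations are numbered from 1. Every state has a successor,
    so no invariant is carried.\<close>
  define P where "P = (\<lambda>(n::nat) s. n = 0 \<longrightarrow> s = (x0, x0, x0, 0::real, 0::real, 0::nat))"
  have "\<exists>\<sigma>. \<forall>n. P n (\<sigma> n) \<and> Q n (\<sigma> n) (\<sigma> (Suc n))"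
  proof (rule dependent_nat_choice)
    fix s :: "'a \<times> 'a \<times> 'a \<times> real \<times> real \<times> nat" and n
    obtain x y z A a T where s: "s = (x, y, z, A, a, T)" by (cases s) auto
    define a' where "a' = (1 / L + sqrt (1 / L\<^sup>2 + 4 * A / L)) / 2"
    define x' where "x' = (A / (A + a')) *\<^sub>R y + (a' / (A + a')) *\<^sub>R z"
    obtain t where t: "1 \<le> t" "stopping_test f L x' (M (aux_function f L x') x' t)"
      "\<And>s. 1 \<le> s \<Longrightarrow> s < t \<Longrightarrow> \<not> stopping_test f L x' (M (aux_function f L x') x' s)"
      "real t \<le> 72 * c * C + 1"
      using inner_loop_terminates[OF assms] by blast
    define y' where "y' = M (aux_function f L x') x' t"
    have "Q n s (x', y', z - a' *\<^sub>R gradient f y', A + a', a', t)"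
      unfolding Q_def s prod.case using t a'_def x'_def y'_def by blast
    then show "\<exists>s'. P (Suc n) s' \<and> Q n s s'" unfolding P_def by blast
  qed (simp add: P_def)
  then obtain \<sigma> where \<sigma>: "P 0 (\<sigma> 0)" "\<And>n. Q n (\<sigma> n) (\<sigma> (Suc n))" by blast
  define x where "x n = fst (\<sigma> n)" for n
  define y where "y n = fst (snd (\<sigma> n))" for n
  define z where "z n = fst (snd (snd (\<sigma> n)))" for n
  define A where "A n = fst (snd (snd (snd (\<sigma> n))))" for n
  define a where "a n = fst (snd (snd (snd (snd (\<sigma> n)))))" for n
  define T where "T n = snd (snd (snd (snd (snd (\<sigma> n)))))" for n
  have \<sigma>_eq: "\<sigma> n = (x n, y n, z n, A n, a n, T n)" for n
    by (simp add: x_def y_def z_def A_def a_def T_def)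
  have step: "Q n (x n, y n, z n, A n, a n, T n)
      (x (Suc n), y (Suc n), z (Suc n), A (Suc n), a (Suc n), T (Suc n))" for n
    using \<sigma>(2) unfolding \<sigma>_eq .
  have "catalyst_run f M (\<lambda>_. L) x0 N x y z A a T" for N
    using \<sigma>(1) step unfolding catalyst_run_def P_def Q_def \<sigma>_eq Let_def prod.case prod.inject
    by blast
  moreover have "real (T k) \<le> 72 * c * C + 1" if k: "1 \<le> k" for k
  proof -
    obtain j where "k = Suc j" using k by (cases k) auto
    then show ?thesis using step[of j] unfolding Q_def prod.case by blast
  qed
  ultimately show ?thesis using that by blast
qed

section \<open>Potential argument for the outer iterations\<close>

text \<open>The formula for \<open>a\<close> is the positive root of
  \<open>L * a^2 - a - A = 0\<close>. This equation balances the squared gradient norms in the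
  potential step.\<close>

lemma catalyst_step_size:
  fixes A L :: real
  assumes "0 < L" "0 \<le> A" "a = (1 / L + sqrt (1 / L\<^sup>2 + 4 * A / L)) / 2"
  shows "0 < a" "L * a\<^sup>2 = A + a"
proof -
  define s where "s = sqrt (1 / L\<^sup>2 + 4 * A / L)"
  have s: "0 \<le> s" "s\<^sup>2 = 1 / L\<^sup>2 + 4 * A / L"
    using assms(1,2) by (auto simp: s_def)
  then show "0 < a"
    using assms(1) by (simp add: assms(3) s_def[symmetric] add_pos_nonneg)
  have "L * a\<^sup>2 = L * (1 / L\<^sup>2 + 2 * s / L + s\<^sup>2) / 4"
    unfolding assms(3) s_def[symmetric] using assms(1) by (simp add: power2_eq_square field_simps)
  also have "\<dots> = A + a"
    unfolding s(2) assms(3) s_def[symmetric] using assms(1)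
    by (simp add: power2_eq_square field_simps)
  finally show "L * a\<^sup>2 = A + a" .
qed

text \<open>Square the test, weaken the factor 1/2 on its right-hand side to 1, and expand: the
  terms \<open>L^2 * (norm d)^2\<close> cancel, and division by \<open>2 * L\<close>
  remains.\<close>

lemma stopping_test_imp_progress:
  assumes "smooth_function K f" "0 < L" "stopping_test f L x y"
  shows "inner (gradient f y) (y - x) + (norm (gradient f y))\<^sup>2 / (2 * L) \<le> 0"
proof -
  define g where "g = gradient f y"
  define d where "d = y - x"
  have "norm (g + L *\<^sub>R d) \<le> L / 2 * norm d"
    using assms(3) by (simp add: stopping_test_def gradient_aux_function[OF assms(1)] g_def d_def)
  then have "(norm (g + L *\<^sub>R d))\<^sup>2 \<le> (L / 2 * norm d)\<^sup>2"
    by (rule power_mono) simp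
  moreover have "(norm (g + L *\<^sub>R d))\<^sup>2 = (norm g)\<^sup>2 + 2 * L * inner g d + L\<^sup>2 * (norm d)\<^sup>2"
    unfolding power2_norm_eq_inner by (simp add: algebra_simps inner_commute power2_eq_square)
  moreover have "(L / 2 * norm d)\<^sup>2 \<le> L\<^sup>2 * (norm d)\<^sup>2"
    by (simp add: power_mult_distrib power_divide)
  ultimately have "(norm g)\<^sup>2 + 2 * L * inner g d \<le> 0" by linarith
  then have "((norm g)\<^sup>2 + 2 * L * inner g d) / (2 * L) \<le> 0"
    using assms(2) by (simp add: divide_le_0_iff)
  then show ?thesis
    using assms(2) by (simp add: g_def d_def add_divide_distrib)
qed

text \<open>Add the tangent inequalities at \<open>y'\<close> towards \<open>y\<close> and
  \<open>xs\<close> with weights \<open>A\<close> and \<open>a\<close>, and expand the new distance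
  to \<open>xs\<close>. The inner products combine to \<open>(A + a) * inner g (y' - x)\<close>
  because \<open>x\<close> is the weighted mean of \<open>y\<close> and \<open>z\<close>, and the
  progress inequality scaled by \<open>A + a\<close> absorbs what is left.\<close>

lemma catalyst_potential_step:
  assumes "convex_on UNIV f" "0 < L" "smooth_function L f"
    and "0 \<le> A" "0 < a" "L * a\<^sup>2 = A + a"
    and x: "x = (A / (A + a)) *\<^sub>R y + (a / (A + a)) *\<^sub>R z"
    and "stopping_test f L x y'"
  shows "(A + a) * (f y' - f xs) + (norm (z - a *\<^sub>R gradient f y' - xs))\<^sup>2 / 2
    \<le> A * (f y - f xs) + (norm (z - xs))\<^sup>2 / 2"
proof -
  define g where "g = gradient f y'"
  \<comment> \<open>Clearing the denominators makes the definition of \<open>x\<close> a linear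
    relation between inner products, as the final \<open>linarith\<close> requires.\<close>
  have "(A + a) *\<^sub>R x = A *\<^sub>R y + a *\<^sub>R z"
    using assms(4,5) by (simp add: x scaleR_add_right)
  then have xg: "(A + a) * inner g x = A * inner g y + a * inner g z"
    by (simp flip: inner_add_right inner_scaleR_right)
  have "f y' + inner g (y - y') \<le> f y" "f y' + inner g (xs - y') \<le> f xs"
    using convex_gradient_inequality[OF assms(1,3)] by (simp_all add: g_def)
  then have "A * (f y' + inner g (y - y')) \<le> A * f y" "a * (f y' + inner g (xs - y')) \<le> a * f xs"
    using assms(4,5) by (auto intro!: mult_left_mono)
  moreover have "(norm (z - a *\<^sub>R g - xs))\<^sup>2 / 2
      = (norm (z - xs))\<^sup>2 / 2 - a * inner g (z - xs) + a\<^sup>2 * (norm g)\<^sup>2 / 2"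
    unfolding power2_norm_eq_inner
    by (simp add: algebra_simps inner_commute power2_eq_square add_divide_distrib diff_divide_distrib)
  moreover have "(A + a) * (inner g (y' - x) + (norm g)\<^sup>2 / (2 * L)) \<le> 0"
    using stopping_test_imp_progress[OF assms(3,2,8)] assms(4,5)
    by (auto simp: g_def mult_nonneg_nonpos)
  moreover have "(A + a) * ((norm g)\<^sup>2 / (2 * L)) = a\<^sup>2 * (norm g)\<^sup>2 / 2"
    using assms(2) by (simp flip: assms(6))
  ultimately show ?thesis
    using xg unfolding g_def[symmetric] inner_diff_right distrib_left distrib_right
      left_diff_distrib right_diff_distrib
    by linarith
qed

lemma catalyst_run_step:
  assumes "catalyst_run f M (\<lambda>_. L) x0 N x y z A a T" "k < N"
  shows "a (Suc k) = (1 / L + sqrt (1 / L\<^sup>2 + 4 * A k / L)) / 2"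
    and "A (Suc k) = A k + a (Suc k)"
    and "x (Suc k) = (A k / A (Suc k)) *\<^sub>R y k + (a (Suc k) / A (Suc k)) *\<^sub>R z k"
    and "stopping_test f L (x (Suc k)) (y (Suc k))"
    and "z (Suc k) = z k - a (Suc k) *\<^sub>R gradient f (y (Suc k))"
proof -
  let ?m = "M (aux_function f L (x (Suc k))) (x (Suc k)) (T (Suc k))"
  have "stopping_test f L (x (Suc k)) ?m" "y (Suc k) = ?m"
    using assms unfolding catalyst_run_def Let_def by blast+
  then show "stopping_test f L (x (Suc k)) (y (Suc k))" by (simp only:)
qed (use assms in \<open>unfold catalyst_run_def Let_def, blast+\<close>)

text \<open>By induction the square root in the step size is at least \<open>k / L\<close>, so each
  step adds at least \<open>(k + 1) / (2 * L)\<close>.\<close>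

lemma catalyst_run_weights:
  assumes "catalyst_run f M (\<lambda>_. L) x0 N x y z A a T" "0 < L" "k \<le> N"
  shows "(real k)\<^sup>2 / (4 * L) \<le> A k"
  using assms(3)
proof (induction k)
  case 0
  then show ?case using assms(1) by (simp add: catalyst_run_def)
next
  case (Suc k)
  then have a: "a (Suc k) = (1 / L + sqrt (1 / L\<^sup>2 + 4 * A k / L)) / 2"
    and A: "A (Suc k) = A k + a (Suc k)"
    using catalyst_run_step[OF assms(1)] by simp_all
  have IH: "(real k)\<^sup>2 / (4 * L) \<le> A k" using Suc by simp
  have "(real k / L)\<^sup>2 = 4 * ((real k)\<^sup>2 / (4 * L)) / L"
    by (simp add: power2_eq_square)
  also have "\<dots> \<le> 4 * A k / L"
    using IH assms(2) by (intro divide_right_mono mult_left_mono) auto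
  also have "\<dots> \<le> 1 / L\<^sup>2 + 4 * A k / L" by simp
  finally have "real k / L \<le> sqrt (1 / L\<^sup>2 + 4 * A k / L)"
    by (rule real_le_rsqrt)
  then have "(1 + real k) / (2 * L) \<le> a (Suc k)"
    unfolding a by (simp add: add_divide_distrib)
  then have "(real k)\<^sup>2 / (4 * L) + (1 + real k) / (2 * L) \<le> A (Suc k)"
    using IH A by simp
  \<comment> \<open>This is \<open>(k + 1)^2 <= k^2 + 2 * (k + 1)\<close>.\<close>
  moreover have "(real (Suc k))\<^sup>2 / (4 * L) \<le> (real k)\<^sup>2 / (4 * L) + (1 + real k) / (2 * L)"
    using assms(2) by (simp add: power2_eq_square field_simps)
  ultimately show ?case by linarith
qed

lemma catalyst_run_potential:
  assumes "convex_on UNIV f" "0 < L" "smooth_function L f"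
    and run: "catalyst_run f M (\<lambda>_. L) x0 N x y z A a T" and "k \<le> N"
  shows "A k * (f (y k) - f xs) + (norm (z k - xs))\<^sup>2 / 2 \<le> (norm (x0 - xs))\<^sup>2 / 2"
  using assms(5)
proof (induction k)
  case 0
  then show ?case using run by (simp add: catalyst_run_def)
next
  case (Suc k)
  then have "k < N" by simp
  note s = catalyst_run_step[OF run this]
  have A0: "0 \<le> A k"
    by (rule order_trans[OF _ catalyst_run_weights[OF run assms(2)]]) (use assms(2) Suc in auto)
  show ?case
    using catalyst_potential_step[OF assms(1-3) A0 catalyst_step_size[OF assms(2) A0 s(1)] s(3)[unfolded s(2)] s(4), of xs]
      Suc by (simp add: s(2,5))
qed

text \<open>The potential bound without its distance term, combined with the quadratic growth of
  \<open>A\<close>. The product form also covers \<open>N = 0\<close>.\<close>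

lemma catalyst_run_rate:
  assumes "convex_on UNIV f" "0 < L" "smooth_function L f" "\<And>u. f xs \<le> f u"
    and run: "catalyst_run f M (\<lambda>_. L) x0 N x y z A a T"
  shows "(real N)\<^sup>2 * (f (y N) - f xs) \<le> 2 * L * (norm (x0 - xs))\<^sup>2"
proof -
  have "(real N)\<^sup>2 / (4 * L) * (f (y N) - f xs) \<le> A N * (f (y N) - f xs)"
    using catalyst_run_weights[OF run assms(2)] assms(4) by (intro mult_right_mono) auto
  also have "\<dots> \<le> A N * (f (y N) - f xs) + (norm (z N - xs))\<^sup>2 / 2" by simp
  also have "\<dots> \<le> (norm (x0 - xs))\<^sup>2 / 2"
    by (rule catalyst_run_potential[OF assms(1-3) run]) simp
  finally show ?thesis using assms(2) by (simp add: field_simps)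
qed

section \<open>Total complexity\<close>

text \<open>The gradient vanishes at the minimiser, since its squared norm is bounded by a gap of
  zero; the descent lemma based there then has no linear term.\<close>

lemma initial_gap:
  assumes "smooth_function L f" "0 < L" "\<And>u. f xs \<le> f u"
  shows "f x0 - f xs \<le> L / 2 * (norm (x0 - xs))\<^sup>2"
proof -
  have "gradient f xs = 0"
    using gradient_norm_le_gap[OF assms, of xs] by simp
  then show ?thesis using descent_lemma[OF assms(1), of x0 xs] by simp
qed

theorem corollary1:
  fixes f :: "real ^ 'n \<Rightarrow> real"
    and M :: "(real ^ 'n) inner_method"
    and x0 x_star :: "real ^ 'n"
    and L\<^sub>f C\<^sub>n C0 c R \<epsilon> :: real
  assumes "convex_on UNIV f"
    and "0 < L\<^sub>f" and "smooth_function L\<^sub>f f"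
    and "\<forall>y. f x_star \<le> f y"
    and "0 < c" and "0 < C0" and "C0 \<le> C\<^sub>n"
    and "convergence_rate M c C\<^sub>n"
    and "R = norm (x0 - x_star)"
    and "0 < \<epsilon>"
  shows "\<exists>N x y z A a T.
           catalyst_run f M (\<lambda>_. L\<^sub>f) x0 N x y z A a T \<and>
           f (y N) - f x_star \<le> \<epsilon> \<and>
           real (\<Sum>k=1..N. T k)
             \<le> complexity_constant c C0 * (C\<^sub>n * sqrt (L\<^sub>f * R\<^sup>2 / \<epsilon>))"
proof -
  have min: "\<And>y. f x_star \<le> f y" using assms(4) by blast
  have C: "0 < C\<^sub>n" using assms(6,7) by linarith
  obtain x y z A a T where run: "\<And>N. catalyst_run f M (\<lambda>_. L\<^sub>f) x0 N x y z A a T"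
    and T: "\<And>k. 1 \<le> k \<Longrightarrow> real (T k) \<le> 72 * c * C\<^sub>n + 1"
    using catalyst_run_exists[OF assms(1-3) min assms(5) C assms(8)] by blast
  define s where "s = sqrt (L\<^sub>f * R\<^sup>2 / \<epsilon>)"
  have s: "0 \<le> s" "s\<^sup>2 = L\<^sub>f * R\<^sup>2 / \<epsilon>"
    using assms(2,10) by (auto simp: s_def)
  have const: "0 \<le> complexity_constant c C0"
    using assms(5,6) by (simp add: complexity_constant_def)
  have "\<exists>N. f (y N) - f x_star \<le> \<epsilon> \<and>
      real (\<Sum>k=1..N. T k) \<le> complexity_constant c C0 * (C\<^sub>n * s)"
  \<comment> \<open>For large \<epsilon> the claimed bound can drop below a single call, so an
    initial \<epsilon>-solution must be answered by the empty run \<open>N = 0\<close>.\<close>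
  proof (cases "f x0 - f x_star \<le> \<epsilon>")
    case True
    then show ?thesis
      using run[of 0] const C s(1) by (intro exI[of _ 0]) (simp add: catalyst_run_def)
  next
    case False
    then have "\<epsilon> < L\<^sub>f / 2 * R\<^sup>2"
      using initial_gap[OF assms(3,2) min, of x0] assms(9) by simp
    then have "1\<^sup>2 \<le> s\<^sup>2"
      using assms(10) by (simp add: s(2) field_simps)
    then have s1: "1 \<le> s" using s(1) power2_le_imp_le by blast
    \<comment> \<open>The rate asks for \<open>2 * s^2 <= N^2\<close>, so \<open>2 * s\<close>
      rounded up suffices; \<open>1 <= s\<close> keeps the rounded value below
      \<open>3 * s\<close>.\<close>
    define N where "N = nat \<lceil>2 * s\<rceil>"
    have N: "2 * s \<le> real N" "real N \<le> 3 * s"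
      using s1 unfolding N_def by linarith+
    have "2 * L\<^sub>f * R\<^sup>2 = 2 * s\<^sup>2 * \<epsilon>"
      using assms(10) by (simp add: s(2))
    also have "\<dots> \<le> (real N)\<^sup>2 * \<epsilon>"
    proof (intro mult_right_mono)
      have "(2 * s)\<^sup>2 \<le> (real N)\<^sup>2" using N(1) s(1) by (intro power_mono) auto
      then show "2 * s\<^sup>2 \<le> (real N)\<^sup>2"
        by (simp add: power_mult_distrib) (use zero_le_power2[of s] in argo)
    qed (use assms(10) in simp)
    finally have "(real N)\<^sup>2 * (f (y N) - f x_star) \<le> (real N)\<^sup>2 * \<epsilon>"
      using catalyst_run_rate[OF assms(1-3) min run, of N] unfolding assms(9) by linarith
    then have "f (y N) - f x_star \<le> \<epsilon>"
      using N(1) s1 by (simp add: mult_le_cancel_left)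
    moreover have "real (\<Sum>k=1..N. T k) \<le> complexity_constant c C0 * (C\<^sub>n * s)"
    proof -
      have "real (\<Sum>k=1..N. T k) \<le> real N * (72 * c * C\<^sub>n + 1)"
        using sum_bounded_above[of "{1..N}" "\<lambda>k. real (T k)" "72 * c * C\<^sub>n + 1"] T by simp
      \<comment> \<open>Here \<open>C0 <= C\<^sub>n\<close> turns the additive 1 per outer iteration
        into the multiple \<open>C\<^sub>n / C0\<close> of \<open>C\<^sub>n\<close>.\<close>
      also have "\<dots> \<le> 3 * s * (72 * c * C\<^sub>n + C\<^sub>n / C0)"
        using N(2) s(1) assms(5-7) C by (intro mult_mono) auto
      also have "\<dots> = (216 * c + 3 * (1 / C0)) * (C\<^sub>n * s)"
        by (simp add: algebra_simps)
      also have "\<dots> \<le> complexity_constant c C0 * (C\<^sub>n * s)"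
      proof (rule mult_right_mono)
        \<comment> \<open>The coefficient 216 is 3 times 72; both coefficients are well below
          1000.\<close>
        have "216 * c + 3 * q \<le> 1000 * (c + q)" if "0 < q" for q :: real
          using that assms(5) by argo
        from this[of "1 / C0"] show "216 * c + 3 * (1 / C0) \<le> complexity_constant c C0"
          using assms(6) unfolding complexity_constant_def by simp
      qed (use C s(1) in simp)
      finally show ?thesis .
    qed
    ultimately show ?thesis by blast
  qed
  then show ?thesis
    using run unfolding s_def by blast
qed

end
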